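(* Consider named agents with NW whiteboards, in the synchronous or asynchronous model, with half-duplex or full-duplex links. When the state space of each agent is bounded (where the bound may depend on the network size $n$), the quiescence number of the $k$-gossip problem (for self-stabilizing solutions) is $-1$.
   Context: Network: a connected graph $G=(V,E)$ with $n=|V|$ nodes. Nodes are anonymous (no identifiers; nodes of the same degree are identical). Each node has locally distinct labels for its incident links; no other assumption is made about the labels. Agents: $k$ mobile agents, each a deterministic state machine, are present at all times; $k$ is unknown to the agents. Named agents: each agent has a unique identifier. NW whiteboards: no information can be stored at nodes. An agent at a node may change its state and move to a neighboring node, based on: its own current state, the current states of other agents at the same node, and the local link labels of the node (and possibly the label of the incoming link used to reach it). Synchronous: lock-step rounds; every agent executes its action at every round and can move to a neighboring node; agents at the same node act in one round but in sequence. Asynchronous: there is no bound on the number of moves an agent can make between any two moves of another agent, but each agent is eventually allowed to execute its action; agents at the same node act sequentially, agents at different nodes may act concurrently. Full-duplex link: two agents at neighboring nodes can exchange positions simultaneously over the link without meeting. Half-duplex link: only one direction can be used at a given time; if two agents at its two ends try to cross simultaneously, only one succeeds. $k$-gossip problem: each of the $k$ agents is given some initial information (gossip information), to be disseminated to every other agent. With NW whiteboards, gossip information is transferred only between agents meeting at a node; an agent may relay all gossip information it has collected. Self-stabilizing solution: every agent eventually knows the gossip information of all the agents even when the system starts from an arbitrary configuration (arbitrary agent locations and states). An algorithm is $l$-quiescent (for an integer $l$) if any execution reaches a configuration after which $l$ or more agents remain still forever. The quiescence number of the problem is the maximum integer $l$ such that an $l$-quiescent self-stabilizing algorithm for it exists;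 it is $-1$ if no $0$-quiescent self-stabilizing algorithm exists (i.e. the problem is not solvable). *)

theory Defs
  imports "Graph_Theory.Graph_Theory"
begin

type_synonym node = nat
type_synonym port = nat
type_synonym agent = nat

datatype synchrony = Synchronous | Asynchronous
datatype duplex = Half_Duplex | Full_Duplex

text \<open>
  A network is a finite connected simple graph. The value \<open>port_label N u v\<close> is the label which
  node \<open>u\<close> gives to its incident link to \<open>v\<close>; the label of the same link at \<open>v\<close> is unrelated.
\<close>

record network =
  graph_of :: "node pair_pre_digraph"
  port_label :: "node \<Rightarrow> node \<Rightarrow> port"

definition neighbours :: "network \<Rightarrow> node \<Rightarrow> node set" where
  "neighbours N u = {v. (u, v) \<in> parcs (graph_of N)}"

definition ports :: "network \<Rightarrow> node \<Rightarrow> port set" where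
  "ports N u = port_label N u ` neighbours N u"

definition is_network :: "network \<Rightarrow> bool" where
  "is_network N \<longleftrightarrow>
     pair_graph (graph_of N) \<and> Digraph_Component.connected (with_proj (graph_of N)) \<and>
     (\<forall>u\<in>pverts (graph_of N). inj_on (port_label N u) (neighbours N u))"

definition link_end :: "network \<Rightarrow> node \<Rightarrow> port \<Rightarrow> node" where
  "link_end N u p = (THE v. v \<in> neighbours N u \<and> port_label N u v = p)"

text \<open>
  Agents are named by natural numbers. In \<open>action A i s others P q\<close>, agent \<open>i\<close> is in state \<open>s\<close>,
  \<open>others\<close> gives the identifiers and current states of the other agents at the same node, \<open>P\<close> is
  the set of the link labels of that node, and \<open>q\<close> is the label there of the link by which \<open>i\<close>
  came (\<open>None\<close> if it has not used a link yet). The result is the new state together with the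
  label of the link to leave by (\<open>None\<close> for not leaving). Nothing about the node itself is
  visible, and nothing can be stored at it.
\<close>

record 's algorithm =
  states :: "agent \<Rightarrow> 's set"
  action :: "agent \<Rightarrow> 's \<Rightarrow> (agent \<rightharpoonup> 's) \<Rightarrow> port set \<Rightarrow> port option \<Rightarrow> 's \<times> port option"

definition well_formed :: "'s algorithm \<Rightarrow> bool" where
  "well_formed A \<longleftrightarrow>
     (\<forall>i. states A i \<noteq> {} \<and>
       (\<forall>s\<in>states A i. \<forall>others P q.
          (\<forall>j s'. others j = Some s' \<longrightarrow> s' \<in> states A j) \<longrightarrow>
          fst (action A i s others P q) \<in> states A i \<and>
          set_option (snd (action A i s others P q)) \<subseteq> P))"

text \<open>
  The field \<open>known\<close> records whose gossip information an agent has collected. It is bookkeeping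
  only: it is neither visible to the algorithm nor part of the agent state, so that a bound on the
  states does not limit how much gossip information can be carried and relayed.
\<close>

record 's config =
  location :: "agent \<Rightarrow> node"
  in_port :: "agent \<Rightarrow> port option"
  state :: "agent \<Rightarrow> 's"
  known :: "agent \<Rightarrow> agent set"

definition initial :: "network \<Rightarrow> 's algorithm \<Rightarrow> agent set \<Rightarrow> 's config \<Rightarrow> bool" where
  "initial N A I c \<longleftrightarrow>
     (\<forall>i\<in>I. location c i \<in> pverts (graph_of N) \<and> state c i \<in> states A i \<and>
            set_option (in_port c i) \<subseteq> ports N (location c i) \<and> known c i = {i})"

text \<open>
  The action of one agent updates the current states and the intended moves. Moves take
  effect together at the end of a step, hence \<open>location c\<close> stays fixed while the agents that are
  active in the step act one after another.
\<close>

definition act ::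
  "network \<Rightarrow> 's algorithm \<Rightarrow> agent set \<Rightarrow> 's config \<Rightarrow> agent \<Rightarrow>
   (agent \<Rightarrow> 's) \<times> (agent \<rightharpoonup> port) \<Rightarrow> (agent \<Rightarrow> 's) \<times> (agent \<rightharpoonup> port)" where
  "act N A I c i = (\<lambda>(\<sigma>, \<mu>).
     let others = (\<lambda>j. if j \<in> I \<and> j \<noteq> i \<and> location c j = location c i then Some (\<sigma> j) else None);
         (s, m) = action A i (\<sigma> i) others (ports N (location c i)) (in_port c i)
     in (\<sigma>(i := s), \<mu>(i := m)))"

definition opposed :: "(agent \<Rightarrow> node) \<Rightarrow> (agent \<rightharpoonup> node) \<Rightarrow> agent \<Rightarrow> agent \<Rightarrow> bool" where
  "opposed loc target i j \<longleftrightarrow> target i = Some (loc j) \<and> target j = Some (loc i)"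

text \<open>
  \<open>M\<close> is a possible set of agents whose moves succeed. On a half-duplex link with agents trying to
  cross from both ends, exactly one direction succeeds, and either one may.
\<close>

definition successful_moves ::
  "duplex \<Rightarrow> agent set \<Rightarrow> (agent \<Rightarrow> node) \<Rightarrow> (agent \<rightharpoonup> node) \<Rightarrow> agent set \<Rightarrow> bool" where
  "successful_moves d I loc target M \<longleftrightarrow>
     M \<subseteq> {i\<in>I. target i \<noteq> None} \<and>
     (case d of
        Full_Duplex \<Rightarrow> {i\<in>I. target i \<noteq> None} \<subseteq> M
      | Half_Duplex \<Rightarrow>
          (\<forall>i\<in>M. \<forall>j\<in>M. \<not> opposed loc target i j) \<and>
          (\<forall>i\<in>{i\<in>I. target i \<noteq> None} - M. \<exists>j\<in>M. opposed loc target i j))"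

text \<open>
  In a step the agents of the list \<open>xs\<close> act, in that order. All agents at the same node exchange
  all gossip information they have, whether or not they act.
\<close>

definition step ::
  "duplex \<Rightarrow> network \<Rightarrow> 's algorithm \<Rightarrow> agent set \<Rightarrow> agent list \<Rightarrow> 's config \<Rightarrow> 's config \<Rightarrow> bool"
where
  "step d N A I xs c c' \<longleftrightarrow>
     (let (\<sigma>, \<mu>) = fold (act N A I c) xs (state c, \<lambda>_. None);
          target = (\<lambda>i. map_option (link_end N (location c i)) (\<mu> i))
      in \<exists>M. successful_moves d I (location c) target M \<and>
           c' = \<lparr> location = (\<lambda>i. if i \<in> M then the (target i) else location c i),
                  in_port = (\<lambda>i. if i \<in> M then Some (port_label N (the (target i)) (location c i))
                                 else in_port c i),
                  state = \<sigma>,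
                  known = (\<lambda>i. \<Union>j\<in>{j\<in>I. location c j = location c i}. known c j) \<rparr>)"

text \<open>
  In the synchronous model one step is one round. In the asynchronous model agents at different
  nodes may act in the same step, agents at the same node may not.
\<close>

definition execution ::
  "synchrony \<Rightarrow> duplex \<Rightarrow> network \<Rightarrow> 's algorithm \<Rightarrow> agent set \<Rightarrow> (nat \<Rightarrow> 's config) \<Rightarrow> bool" where
  "execution m d N A I c \<longleftrightarrow>
     initial N A I (c 0) \<and>
     (\<exists>xs :: nat \<Rightarrow> agent list.
        (\<forall>t. distinct (xs t) \<and> set (xs t) \<subseteq> I \<and> step d N A I (xs t) (c t) (c (Suc t))) \<and>
        (case m of
           Synchronous \<Rightarrow> \<forall>t. set (xs t) = I
         | Asynchronous \<Rightarrow>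
             (\<forall>t. inj_on (location (c t)) (set (xs t))) \<and>
             (\<forall>i\<in>I. \<forall>t. \<exists>t'\<ge>t. i \<in> set (xs t'))))"

text \<open>
  Below, \<open>A n\<close> is the algorithm used on networks with \<open>n\<close> nodes. An algorithm which is not told the
  network size is the special case of a constant \<open>A\<close>.
\<close>

definition self_stabilizing_gossip ::
  "synchrony \<Rightarrow> duplex \<Rightarrow> (nat \<Rightarrow> 's algorithm) \<Rightarrow> nat \<Rightarrow> bool" where
  "self_stabilizing_gossip m d A k \<longleftrightarrow>
     (\<forall>N I c. is_network N \<longrightarrow> finite I \<longrightarrow> card I = k \<longrightarrow>
        execution m d N (A (card (pverts (graph_of N)))) I c \<longrightarrow>
        (\<exists>t. \<forall>i\<in>I. I \<subseteq> known (c t) i))"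

definition quiescent ::
  "synchrony \<Rightarrow> duplex \<Rightarrow> nat \<Rightarrow> (nat \<Rightarrow> 's algorithm) \<Rightarrow> nat \<Rightarrow> bool" where
  "quiescent m d l A k \<longleftrightarrow>
     (\<forall>N I c. is_network N \<longrightarrow> finite I \<longrightarrow> card I = k \<longrightarrow>
        execution m d N (A (card (pverts (graph_of N)))) I c \<longrightarrow>
        (\<exists>t. l \<le> card {i\<in>I. \<forall>t'\<ge>t. location (c t') i = location (c t) i}))"

text \<open>
  The quiescence number of gossiping by \<open>k\<close> agents, for algorithms from the class \<open>C\<close>. An algorithm
  may not depend on the number of agents beyond the fact that it belongs to \<open>K\<close>: it has to solve
  the problem for each \<open>k' \<in> K\<close>. Agents to which the number is entirely unknown correspond to
  \<open>K = UNIV\<close>.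
\<close>

definition quiescence_number ::
  "synchrony \<Rightarrow> duplex \<Rightarrow> (nat \<Rightarrow> 's algorithm) set \<Rightarrow> nat set \<Rightarrow> nat \<Rightarrow> int" where
  "quiescence_number m d C K k =
     (let L = {l. \<exists>A\<in>C. (\<forall>n. well_formed (A n)) \<and>
                   (\<forall>k'\<in>K. self_stabilizing_gossip m d A k') \<and> quiescent m d l A k}
      in if 0 \<in> L then int (Max L) else -1)"

text \<open>
  The bound may depend on the network size, but it is the same for all of the infinitely many
  possible identifiers. State sets of different agents need not be related.
\<close>

definition bounded_state_algorithms :: "(nat \<Rightarrow> 's algorithm) set" where
  "bounded_state_algorithms =
     {A. \<exists>B :: nat \<Rightarrow> nat. \<forall>n i. finite (states (A n) i) \<and> card (states (A n) i) \<le> B n}"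

end

theory Submission
  imports Defs "HOL-Library.Countable_Set" "HOL-Number_Theory.Cong"
begin

text \<open>
  On a ring whose links are consistently labelled, infinitely many identifiers share finitely many
  possible behaviours of an agent that stays alone. Choose \<open>k\<close> agents with the same behaviour and
  start them at distinct nodes in corresponding states: they make the same moves forever, hence
  never meet. They never oppose each other on a link either, and agents at different nodes may act
  in the same asynchronous step, so that this one execution exists in all of the models.
\<close>

section \<open>The consistently labelled ring\<close>

definition ring_shift :: "nat \<Rightarrow> port \<Rightarrow> nat" where
  "ring_shift n p = (if p = 0 then 1 else n - 1)"

text \<open>Label 0 leads forward and label 1 backward at every node; adding \<open>n - 1\<close> in
  \<open>ring_shift\<close> is subtracting 1 modulo \<open>n\<close>. With at least 3 nodes the two
  neighbours differ, so testing for the forward one determines the label.\<close>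

definition ring :: "nat \<Rightarrow> network" where
  "ring n = \<lparr> graph_of = \<lparr> pverts = {..<n},
                parcs = {(u, v). u < n \<and> (\<exists>p\<in>{0, 1}. v = (u + ring_shift n p) mod n)} \<rparr>,
              port_label = (\<lambda>u v. if v = (u + 1) mod n then 0 else 1) \<rparr>"

lemma neighbours_ring:
  "u < n \<Longrightarrow> neighbours (ring n) u = (\<lambda>p. (u + ring_shift n p) mod n) ` {0, 1}"
  by (auto simp: neighbours_def ring_def)

text \<open>Replaces modular arithmetic by case distinctions at the two ends of
  \<open>{..<n}\<close>, which simple arithmetic can settle.\<close>

lemma ring_shift_mod:
  assumes "u < n"
  shows "(u + ring_shift n p) mod n =
    (if p = 0 then (if Suc u = n then 0 else Suc u) else (if u = 0 then n - 1 else u - 1))"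
proof -
  have "(u + (n - 1)) mod n = (u - 1) mod n" if "u > 0"
    using that assms by (metis Nat.add_diff_assoc2 Suc_leI add.commute mod_add_self2
      One_nat_def less_imp_le_nat Nat.add_diff_assoc le_trans)
  with assms show ?thesis
    by (auto simp: ring_shift_def)
qed

lemma port_label_ring:
  assumes "3 \<le> n" and "u < n" and "p \<in> {0, 1}"
  shows "port_label (ring n) u ((u + ring_shift n p) mod n) = p"
  using assms ring_shift_mod[OF assms(2), of p] by (auto simp: ring_def split: if_splits)

text \<open>The label of arrival depends only on the label of departure and not on the node, so
  agents that leave by equal labels also arrive by equal labels.\<close>

lemma port_label_ring_back:
  assumes "3 \<le> n" and "u < n" and "p \<in> {0, 1}"
  shows "port_label (ring n) ((u + ring_shift n p) mod n) u = 1 - p"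
proof -
  define v where "v = (u + ring_shift n p) mod n"
  have "v < n" using assms by (simp add: v_def)
  then have "port_label (ring n) v u = (if u = (if Suc v = n then 0 else Suc v) then 0 else 1)"
    using ring_shift_mod[of v n 0] by (simp add: ring_def ring_shift_def)
  moreover have "v = (if p = 0 then (if Suc u = n then 0 else Suc u) else (if u = 0 then n - 1 else u - 1))"
    unfolding v_def by (rule ring_shift_mod[OF assms(2)])
  ultimately show ?thesis
    unfolding v_def[symmetric] using assms
    by (cases "p = 0"; cases "u = 0"; cases "Suc u = n") auto
qed

lemma ports_ring:
  assumes "3 \<le> n" and "u < n"
  shows "ports (ring n) u = {0, 1}"
  using port_label_ring[OF assms, of 0] port_label_ring[OF assms, of 1]
  by (simp add: ports_def neighbours_ring[OF assms(2)])

lemma link_end_ring: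
  assumes "3 \<le> n" and "u < n" and "p \<in> {0, 1}"
  shows "link_end (ring n) u p = (u + ring_shift n p) mod n"
  unfolding link_end_def
proof (rule the_equality)
  show "(u + ring_shift n p) mod n \<in> neighbours (ring n) u \<and>
    port_label (ring n) u ((u + ring_shift n p) mod n) = p"
    using neighbours_ring[OF assms(2)] port_label_ring[OF assms] assms(3) by blast
next
  fix v
  assume "v \<in> neighbours (ring n) u \<and> port_label (ring n) u v = p"
  then show "v = (u + ring_shift n p) mod n"
    using neighbours_ring[OF assms(2)] port_label_ring[OF assms(1,2)] by auto
qed

text \<open>Two steps in the same direction return to the start only if 2 is 0 modulo
  \<open>n\<close>. Hence agents moving in the same direction never try to cross.\<close>

lemma ring_not_opposed:
  assumes "3 \<le> n" and "u < n" and "v = (u + ring_shift n p) mod n"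
  shows "u \<noteq> (v + ring_shift n p) mod n"
proof -
  have "v < n" using assms by simp
  from ring_shift_mod[OF this, of p] ring_shift_mod[OF assms(2), of p] assms
  show ?thesis by (auto split: if_splits)
qed

lemma is_network_ring:
  assumes n: "3 \<le> n"
  shows "is_network (ring n)"
proof -
  let ?G = "graph_of (ring n)"
  have G: "pverts ?G = {..<n}"
    by (simp add: ring_def)
  \<comment> \<open>Writing the backward arc as a forward arc from \<open>v\<close> to
    \<open>u\<close> makes the symmetry of the relation visible.\<close>
  have arcs: "(u, v) \<in> parcs ?G \<longleftrightarrow> u < n \<and> v < n \<and>
      (v = (if Suc u = n then 0 else Suc u) \<or> u = (if Suc v = n then 0 else Suc v))" for u v
    using n ring_shift_mod[of u n 0] ring_shift_mod[of u n 1]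
    by (auto simp: ring_def split: if_splits)
  have sym: "symmetric (with_proj ?G)"
    unfolding symmetric_def with_proj_simps by (rule symI) (auto simp: arcs)
  have "finite (parcs ?G)"
    by (rule finite_subset[of _ "{..<n} \<times> {..<n}"]) (auto simp: arcs)
  with sym n have pg: "pair_graph ?G"
    by unfold_locales (auto simp: arcs G split: if_splits)
  then interpret pair_graph ?G .
  \<comment> \<open>Forward arcs lead from 0 to every node; by symmetry any two nodes are then
    joined through 0.\<close>
  have reach: "0 \<rightarrow>\<^sup>*\<^bsub>with_proj ?G\<^esub> v" if "v < n" for v
    using that
  proof (induction v)
    case 0
    then show ?case by (simp add: G)
  next
    case (Suc v)
    then have "(v, Suc v) \<in> parcs ?G" by (simp add: arcs)
    with Suc show ?case by (metis Suc_lessD reachable_adj_trans)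
  qed
  have "Digraph_Component.connected (with_proj ?G)"
  proof (rule connectedI)
    show "pverts ?G \<noteq> {}" using n by (auto simp: G lessThan_empty_iff)
    fix u v assume "u \<in> pverts ?G" "v \<in> pverts ?G"
    then have "u \<rightarrow>\<^sup>*\<^bsub>with_proj ?G\<^esub> v"
      using reach symmetric_reachable[OF sym] reachable_trans by (metis G lessThan_iff)
    then show "u \<rightarrow>\<^sup>*\<^bsub>mk_symmetric (with_proj ?G)\<^esub> v"
      by (rule reachable_mk_symmetricI)
  qed
  moreover have "inj_on (port_label (ring n) u) (neighbours (ring n) u)" if "u < n" for u
    using port_label_ring[OF n that] unfolding neighbours_ring[OF that] by (auto intro!: inj_onI)
  ultimately show ?thesis
    using pg by (simp add: is_network_def G)
qed

section \<open>Behaviour of agents alone at their nodes\<close>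

text \<open>An agent alone at its node sees no states of others, so no action depends on those taken
  earlier in the list, and acting in sequence amounts to acting simultaneously.\<close>

lemma fold_act_alone:
  assumes "inj_on (location c) I" and "distinct xs" and "set xs \<subseteq> I"
    and "\<And>i. a i = action A i (\<sigma> i) Map.empty (ports N (location c i)) (in_port c i)"
  shows "fold (act N A I c) xs (\<sigma>, \<mu>) =
    (\<lambda>i. if i \<in> set xs then fst (a i) else \<sigma> i, \<lambda>i. if i \<in> set xs then snd (a i) else \<mu> i)"
  using assms(2,3)
\<comment> \<open>\<open>fold\<close> lets the last agent of the list act last; as the list is
  distinct, its state is still the one in \<sigma>.\<close>
proof (induction xs rule: rev_induct)
  case Nil
  then show ?case by simp
next
  case (snoc x xs)
  have "(\<lambda>j. if j \<in> I \<and> j \<noteq> x \<and> location c j = location c x then Some (f j) else None) = Map.empty"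
    for f :: "nat \<Rightarrow> 'a"
    using assms(1) snoc.prems by (auto simp: fun_eq_iff dest: inj_onD)
  with snoc show ?case
    by (auto simp: act_def assms(4) fun_eq_iff Let_def case_prod_beta)
qed

text \<open>
  States are numbered separately for each agent, which makes the behaviours of agents with
  unrelated state sets comparable.
\<close>

definition ring_behaviour ::
  "'s algorithm \<Rightarrow> agent \<Rightarrow> nat \<times> port option \<Rightarrow> nat \<times> port option" where
  "ring_behaviour A i = (\<lambda>(x, q).
     let (s, p) = action A i (from_nat_into (states A i) x) Map.empty {0, 1} q
     in (to_nat_on (states A i) s, p))"

text \<open>Contains the possible moves as well as the possible incoming labels, so a behaviour
  table maps a finite set to itself.\<close>

abbreviation ring_in_ports :: "port option set" where
  "ring_in_ports \<equiv> {None, Some 0, Some 1}"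

text \<open>A number that encodes no state is still decoded by \<open>from_nat_into\<close> to some
  state, since the state set is nonempty. One bound \<open>b\<close> therefore serves agents with
  different numbers of states.\<close>

lemma action_ring:
  assumes "well_formed A" and "finite (states A i)" and "card (states A i) \<le> b"
    and "ring_behaviour A i (x, q) = (y, p)"
  shows "action A i (from_nat_into (states A i) x) Map.empty {0, 1} q =
      (from_nat_into (states A i) y, p)"
    and "y < b" and "p \<in> ring_in_ports"
proof -
  let ?S = "states A i"
  obtain s p' where a: "action A i (from_nat_into ?S x) Map.empty {0, 1} q = (s, p')"
    by fastforce
  with assms(4) have y: "y = to_nat_on ?S s" and p: "p' = p"
    by (auto simp: ring_behaviour_def)
  have "?S \<noteq> {}" using assms(1) by (simp add: well_formed_def)
  then have "from_nat_into ?S x \<in> ?S" by (rule from_nat_into)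
  with assms(1) have "fst (action A i (from_nat_into ?S x) Map.empty {0, 1} q) \<in> ?S \<and>
      set_option (snd (action A i (from_nat_into ?S x) Map.empty {0, 1} q)) \<subseteq> {0, 1}"
    unfolding well_formed_def by (metis option.distinct(1))
  then have s: "s \<in> ?S" and p': "set_option p \<subseteq> {0, 1}" using a p by auto
  show "action A i (from_nat_into ?S x) Map.empty {0, 1} q = (from_nat_into ?S y, p)"
    using a y p s assms(2) by (simp add: countable_finite)
  have "y \<in> {..<card ?S}"
    unfolding y using s by (rule bij_betw_apply[OF to_nat_on_finite[OF assms(2)]])
  with assms(3) show "y < b" by simp
  show "p \<in> ring_in_ports" using p' by (cases p) auto
qed

lemma ex_same_ring_behaviour:
  assumes "well_formed A" and "\<And>i. finite (states A i)" and "\<And>i. card (states A i) \<le> b"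
  shows "\<exists>I. finite I \<and> card I = k \<and>
    (\<forall>i\<in>I. \<forall>j\<in>I. \<forall>x<b. \<forall>q\<in>ring_in_ports. ring_behaviour A i (x, q) = ring_behaviour A j (x, q))"
proof -
  let ?D = "{..<b} \<times> ring_in_ports"
  \<comment> \<open>Only the entries on the finite set \<open>?D\<close> matter; restricting to it
    places every table in a finite function space.\<close>
  let ?T = "\<lambda>i. restrict (ring_behaviour A i) ?D"
  have "?T i \<in> ?D \<rightarrow>\<^sub>E ?D" for i
  proof (rule restrict_PiE_iff[THEN iffD2], intro ballI)
    fix z assume "z \<in> ?D"
    show "ring_behaviour A i z \<in> ?D"
      using action_ring(2,3)[OF assms(1) assms(2)[of i] assms(3)[of i]]
      by (metis mem_Sigma_iff lessThan_iff surj_pair)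
  qed
  moreover have "finite (?D \<rightarrow>\<^sub>E ?D)" by (intro finite_PiE) auto
  ultimately have "finite (range ?T)" by (meson finite_subset image_subsetI)
  \<comment> \<open>Some table is shared by infinitely many identifiers, among which any number
    \<open>k\<close> can be chosen.\<close>
  from pigeonhole_infinite[OF infinite_UNIV_nat this]
  obtain a where a: "infinite {i. ?T i = ?T a}" by auto
  then obtain I where I: "finite I" "card I = k" "I \<subseteq> {i. ?T i = ?T a}"
    using infinite_arbitrarily_large by blast
  have "ring_behaviour A i (x, q) = ring_behaviour A a (x, q)"
    if "i \<in> I" "x < b" "q \<in> ring_in_ports" for i x q
  proof -
    have "?T i = ?T a" using I(3) that(1) by blast
    then have "?T i (x, q) = ?T a (x, q)" by (rule fun_cong)
    moreover have "(x, q) \<in> ?D" using that(2,3) by simp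
    ultimately show ?thesis by (simp only: restrict_apply if_True)
  qed
  with I(1,2) show ?thesis by metis
qed

section \<open>Configurations in lockstep\<close>

text \<open>\<open>x\<close> is the common state number and \<open>r\<close> the common displacement from the initial positions.\<close>

definition lockstep ::
  "'s algorithm \<Rightarrow> agent set \<Rightarrow> nat \<Rightarrow> nat \<Rightarrow> nat \<Rightarrow> port option \<Rightarrow> nat \<Rightarrow> 's config \<Rightarrow> bool" where
  "lockstep A I n b x q r c \<longleftrightarrow> x < b \<and> q \<in> ring_in_ports \<and>
     (\<forall>i\<in>I. location c i = (to_nat_on I i + r) mod n \<and> in_port c i = q \<and>
            state c i = from_nat_into (states A i) x \<and> known c i = {i})"

text \<open>\<open>to_nat_on I\<close> numbers the agents from 0 to \<open>card I - 1\<close>, which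
  are distinct residues modulo \<open>n\<close>; a common displacement keeps them distinct.\<close>

lemma lockstep_inj_on_location:
  assumes "lockstep A I n b x q r c" and "finite I" and "card I \<le> n"
  shows "inj_on (location c) I"
proof (rule inj_onI)
  fix i j assume ij: "i \<in> I" "j \<in> I" "location c i = location c j"
  have bij: "bij_betw (to_nat_on I) I {..<card I}"
    by (rule to_nat_on_finite[OF assms(2)])
  then have "to_nat_on I i < n" "to_nat_on I j < n"
    using ij assms(3) by (auto dest!: bij_betwE intro: less_le_trans)
  moreover have "[to_nat_on I i + r = to_nat_on I j + r] (mod n)"
    using assms(1) ij by (simp add: lockstep_def cong_def)
  ultimately have "to_nat_on I i = to_nat_on I j"
    by (simp add: cong_add_rcancel_nat cong_less_modulus_unique_nat)
  then show "i = j" using bij ij by (meson bij_betw_def inj_onD)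
qed

text \<open>All agents are alone and consult the same entry of a common table, so they get the same
  new state number and make the same move, which shifts all locations alike.\<close>

lemma lockstep_step:
  assumes A: "well_formed A" "\<And>i. finite (states A i)" "\<And>i. card (states A i) \<le> b"
    and I: "finite I" "I \<noteq> {}" "card I \<le> n" and n: "3 \<le> n"
    and same: "\<forall>i\<in>I. \<forall>j\<in>I. \<forall>x<b. \<forall>q\<in>ring_in_ports.
      ring_behaviour A i (x, q) = ring_behaviour A j (x, q)"
    and xs: "distinct xs" "set xs = I"
    and c: "lockstep A I n b x q r c"
  shows "\<exists>c' x' q' r'. lockstep A I n b x' q' r' c' \<and> step d (ring n) A I xs c c'"
proof -
  note inj = lockstep_inj_on_location[OF c I(1,3)]
  have xq: "x < b" "q \<in> ring_in_ports" using c by (auto simp: lockstep_def)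
  have ci: "location c i = (to_nat_on I i + r) mod n" "in_port c i = q"
      "state c i = from_nat_into (states A i) x" "known c i = {i}" if "i \<in> I" for i
    using c that by (auto simp: lockstep_def)
  have loc: "location c i < n" if "i \<in> I" for i using ci(1)[OF that] n by simp
  obtain i0 where i0: "i0 \<in> I" using I by blast
  obtain y p where "ring_behaviour A i0 (x, q) = (y, p)" by fastforce
  then have beh: "ring_behaviour A i (x, q) = (y, p)" if "i \<in> I" for i
    using same i0 that xq by metis
  note act_i = action_ring[OF A(1) A(2) A(3) beh]
  have y: "y < b" and p: "p \<in> ring_in_ports" using act_i(2,3)[OF i0] by auto
  define a where "a = (\<lambda>i. action A i (state c i) Map.empty (ports (ring n) (location c i)) (in_port c i))"
  have a: "a i = (from_nat_into (states A i) y, p)" if "i \<in> I" for i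
    unfolding a_def ports_ring[OF n loc[OF that]] ci(2,3)[OF that] by (rule act_i(1)[OF that])
  define \<sigma> where "\<sigma> = (\<lambda>i. if i \<in> I then fst (a i) else state c i)"
  define \<mu> where "\<mu> = (\<lambda>i. if i \<in> I then snd (a i) else None)"
  have fold: "fold (act (ring n) A I c) xs (state c, \<lambda>_. None) = (\<sigma>, \<mu>)"
    using fold_act_alone[OF inj xs(1), of a A "state c" "ring n" "\<lambda>_. None"]
    by (simp add: a_def \<sigma>_def \<mu>_def xs(2))
  define target where "target = (\<lambda>i. map_option (link_end (ring n) (location c i)) (\<mu> i))"
  \<comment> \<open>All intended moves succeed: none are opposed, so this choice is admissible for
    half-duplex links too.\<close>
  define M where "M = {i\<in>I. target i \<noteq> None}"
  have tgt: "target i = (case p of None \<Rightarrow> None | Some s \<Rightarrow> Some ((location c i + ring_shift n s) mod n))"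
    if "i \<in> I" for i
    using p that by (auto simp: target_def \<mu>_def a link_end_ring[OF n loc])
  have not_opp: "\<not> opposed (location c) target i j" if "i \<in> I" "j \<in> I" for i j
  proof (cases p)
    case (Some s)
    then show ?thesis
      using ring_not_opposed[OF n loc[OF that(1)] refl, of s] by (auto simp: opposed_def tgt that)
  qed (simp add: opposed_def tgt that)
  have succ: "successful_moves d I (location c) target M"
    using not_opp by (auto simp: successful_moves_def M_def split: duplex.splits)
  define c' where "c' = \<lparr> location = (\<lambda>i. if i \<in> M then the (target i) else location c i),
                  in_port = (\<lambda>i. if i \<in> M then Some (port_label (ring n) (the (target i)) (location c i))
                                 else in_port c i),
                  state = \<sigma>,
                  known = (\<lambda>i. \<Union>j\<in>{j\<in>I. location c j = location c i}. known c j) \<rparr>"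
  have "step d (ring n) A I xs c c'"
    unfolding step_def fold Let_def prod.case c'_def target_def
    by (intro exI[of _ M] conjI succ[unfolded target_def] refl)
  moreover have "\<exists>x' q' r'. lockstep A I n b x' q' r' c'"
  proof -
    \<comment> \<open>Information is exchanged at the locations before the move, where each agent is
      alone.\<close>
    have known: "known c' i = {i}" if "i \<in> I" for i
    proof -
      have "{j\<in>I. location c j = location c i} = {i}"
        using inj that by (auto dest: inj_onD)
      then show ?thesis by (simp add: c'_def ci(4) that)
    qed
    have state: "state c' i = from_nat_into (states A i) y" if "i \<in> I" for i
      by (simp add: c'_def \<sigma>_def that a)
    show ?thesis
    proof (cases p)
      case None
      then have "lockstep A I n b y q r c'"
        using y xq(2) known state ci by (auto simp: lockstep_def) (auto simp: c'_def M_def tgt ci)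
      then show ?thesis by blast
    next
      case (Some s)
      have s: "s \<in> {0, 1}" using p Some by auto
      have M: "i \<in> M" if "i \<in> I" for i using that tgt Some by (simp add: M_def)
      have "location c' i = (to_nat_on I i + (r + ring_shift n s)) mod n"
        and "in_port c' i = Some (1 - s)" if "i \<in> I" for i
        using port_label_ring_back[OF n loc[OF that] s]
        by (simp_all add: c'_def M that tgt Some ci(1)[OF that] mod_add_left_eq add.assoc)
      \<comment> \<open>The link left by label \<open>s\<close> is entered by the opposite label,
        again the same for all agents.\<close>
      then have "lockstep A I n b y (Some (1 - s)) (r + ring_shift n s) c'"
        using y known state s by (auto simp: lockstep_def)
      then show ?thesis by blast
    qed
  qed
  ultimately show ?thesis by blast
qed

section \<open>An execution without meetings\<close>

lemma bounded_not_self_stabilizing: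
  assumes k: "2 \<le> k" and A: "A \<in> bounded_state_algorithms" "\<And>n. well_formed (A n)"
  shows "\<not> self_stabilizing_gossip m d A k"
proof
  assume gossip: "self_stabilizing_gossip m d A k"
  \<comment> \<open>Leaves room for \<open>k\<close> agents at distinct nodes and gives at least 3
    nodes already for \<open>k = 2\<close>.\<close>
  define n where "n = k + 1"
  have n: "3 \<le> n" using k by (simp add: n_def)
  obtain B where "\<forall>n i. finite (states (A n) i) \<and> card (states (A n) i) \<le> B n"
    using A(1) by (auto simp: bounded_state_algorithms_def)
  then have S: "\<And>i. finite (states (A n) i)" "\<And>i. card (states (A n) i) \<le> B n" by auto
  from ex_same_ring_behaviour[OF A(2) S, of k]
  obtain I where I: "finite I" "card I = k"
    and same: "\<forall>i\<in>I. \<forall>j\<in>I. \<forall>x<B n. \<forall>q\<in>ring_in_ports.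
      ring_behaviour (A n) i (x, q) = ring_behaviour (A n) j (x, q)"
    by auto
  have I': "I \<noteq> {}" "card I \<le> n" using I k by (auto simp: n_def)
  have ne: "states (A n) i \<noteq> {}" for i using A(2)[of n] by (simp add: well_formed_def)
  have "0 < B n" using S ne by (metis card_gt_0_iff less_le_trans)
  obtain xs where xs: "distinct xs" "set xs = I"
    using finite_distinct_list[OF I(1)] by blast
  define P where "P = (\<lambda>c. \<exists>x q r. lockstep (A n) I n (B n) x q r c)"
  define c0 where "c0 = \<lparr> location = (\<lambda>i. to_nat_on I i mod n), in_port = (\<lambda>_. None),
    state = (\<lambda>i. from_nat_into (states (A n) i) 0), known = (\<lambda>i. {i}) \<rparr>"
  have init: "lockstep (A n) I n (B n) 0 None 0 c0"
    using \<open>0 < B n\<close> by (simp add: lockstep_def c0_def)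
  \<comment> \<open>The conjunct for \<open>t = 0\<close> fixes the start of the chosen sequence,
    since \<open>P\<close> alone does not give all that \<open>initial\<close> requires.\<close>
  have "\<exists>f. \<forall>t. (P (f t) \<and> (t = 0 \<longrightarrow> f t = c0)) \<and> step d (ring n) (A n) I xs (f t) (f (Suc t))"
  proof (rule dependent_nat_choice)
    show "\<exists>c. P c \<and> (0 = (0::nat) \<longrightarrow> c = c0)" using init by (auto simp: P_def)
    fix c and t :: nat assume "P c \<and> (t = 0 \<longrightarrow> c = c0)"
    then obtain x q r where "lockstep (A n) I n (B n) x q r c" by (auto simp: P_def)
    from lockstep_step[OF A(2) S I(1) I' n same xs this, of d]
    show "\<exists>c'. (P c' \<and> (Suc t = 0 \<longrightarrow> c' = c0)) \<and> step d (ring n) (A n) I xs c c'"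
      unfolding P_def by blast
  qed
  then obtain c where c: "\<And>t. P (c t)" "c 0 = c0"
      "\<And>t. step d (ring n) (A n) I xs (c t) (c (Suc t))" by metis
  have inj: "inj_on (location (c t)) I" for t
    using c(1)[of t] lockstep_inj_on_location I(1) I'(2) unfolding P_def by blast
  have "initial (ring n) (A n) I (c 0)"
    using n ne by (simp add: initial_def c(2) c0_def ring_def from_nat_into)
  \<comment> \<open>Every agent acts in every step, which gives synchronous rounds and asynchronous
    fairness; distinct locations make this a legal asynchronous step.\<close>
  then have "execution m d (ring n) (A n) I c"
    unfolding execution_def using xs c(3) inj
    by (intro conjI exI[of _ "\<lambda>_. xs"]) (auto split: synchrony.splits)
  moreover have "card (pverts (graph_of (ring n))) = n" by (simp add: ring_def)
  ultimately obtain t where t: "\<forall>i\<in>I. I \<subseteq> known (c t) i"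
    using gossip is_network_ring[OF n] I unfolding self_stabilizing_gossip_def by metis
  obtain i where i: "i \<in> I" using I' by blast
  then have "known (c t) i = {i}" using c(1)[of t] by (auto simp: P_def lockstep_def)
  with t i have "I \<subseteq> {i}" by blast
  then have "card I \<le> 1" using card_mono[of "{i}" I] by simp
  with I k show False by simp
qed

theorem theorem4:
  fixes m :: synchrony and d :: duplex and k :: nat and K :: "nat set"
  assumes "k \<ge> 2" and "k \<in> K"
  shows "quiescence_number m d (bounded_state_algorithms :: (nat \<Rightarrow> 's algorithm) set) K k = -1"
proof -
  have "\<not> self_stabilizing_gossip m d A k"
    if "A \<in> bounded_state_algorithms" "\<forall>n. well_formed (A n)" for A :: "nat \<Rightarrow> 's algorithm"
    using bounded_not_self_stabilizing[OF assms(1)] that by blast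
  \<comment> \<open>An algorithm counted in the set would solve gossiping for every number in
    \<open>K\<close>, in particular for \<open>k\<close>.\<close>
  with assms(2) have "0 \<notin> {l. \<exists>A\<in>bounded_state_algorithms :: (nat \<Rightarrow> 's algorithm) set.
      (\<forall>n. well_formed (A n)) \<and> (\<forall>k'\<in>K. self_stabilizing_gossip m d A k') \<and> quiescent m d l A k}"
    by blast
  then show ?thesis
    unfolding quiescence_number_def Let_def by (rule if_not_P)
qed

end
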